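(* Let $\mathcal{A}(s)=sE-A$ with $E,A\in\mathbb{C}^{n\times n}$ be a regular matrix pencil, let $u,v\in\mathbb{C}^n$ be fixed, and let $\mathcal{P}(s)=(su+v)w^*$ with $w\in\mathbb{C}^n$ be such that $(\mathcal{A}+\mathcal{P})(s)$ is regular. Set $M(\mathcal{A},u,v):=\sum_{\mu\in\sigma(\mathcal{A})}m_{u,v}(\mu)$. Then for $\lambda\in\sigma(\mathcal{A})$ $$\dim\mathcal{L}_{\lambda}(\mathcal{A})-m_{u,v}(\lambda)\leq\dim\mathcal{L}_{\lambda}(\mathcal{A}+\mathcal{P})\leq\dim\mathcal{L}_{\lambda}(\mathcal{A})+M(\mathcal{A},u,v)-m_{u,v}(\lambda),$$ and for $\lambda\in\overline{\mathbb{C}}\setminus\sigma(\mathcal{A})$ $$0\leq\dim\mathcal{L}_{\lambda}(\mathcal{A}+\mathcal{P})\leq M(\mathcal{A},u,v).$$ Moreover, $$\sum_{\lambda\in\sigma(\mathcal{A})}\dim\mathcal{L}_{\lambda}(\mathcal{A}+\mathcal{P})\geq n-M(\mathcal{A},u,v),\qquad \sum_{\lambda\in\sigma(\mathcal{A}+\mathcal{P})\setminus\sigma(\mathcal{A})}\dim\mathcal{L}_{\lambda}(\mathcal{A}+\mathcal{P})\leq M(\mathcal{A},u,v).$$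
   Context: $\overline{\mathbb{C}}:=\mathbb{C}\cup\{\infty\}$. A matrix pencil is $\mathcal{A}(s)=sE-A$ with $E,A\in\mathbb{C}^{n\times n}$; sums of pencils are formed pointwise. It is regular if $\det(sE-A)$ is not the zero polynomial. The spectrum $\sigma(\mathcal{A})\subseteq\overline{\mathbb{C}}$ consists of all $\lambda\in\mathbb{C}$ for which $\lambda E-A$ is singular, together with $\infty$ if $E$ is singular. Jordan chains: $\{g_0,\ldots,g_{m-1}\}\subset\mathbb{C}^n$ is a Jordan chain of length $m$ at $\lambda\in\mathbb{C}$ if $g_0\neq0$, $(A-\lambda E)g_0=0$ and $(A-\lambda E)g_j=Eg_{j-1}$ for $1\le j\le m-1$; it is a Jordan chain of length $m$ at $\infty$ if $g_0\neq0$, $Eg_0=0$ and $Eg_j=Ag_{j-1}$ for $1\le j\le m-1$. The root subspace $\mathcal{L}_\lambda(\mathcal{A})$, $\lambda\in\overline{\mathbb{C}}$, is the subspace consisting of the zero vector and all elements of all Jordan chains of $\mathcal{A}(s)$ at $\lambda$. For $\lambda\in\sigma(\mathcal{A})\setminus\{\infty\}$, $m_{u,v}(\lambda)$ is the order of $\lambda$ as a pole of the vector-valued rational function $s\mapsto(sE-A)^{-1}(su+v)$, i.e. the maximal order of $\lambda$ as a pole of one of its entries, and $m_{u,v}(\lambda)=0$ if no entry has a pole at $\lambda$. If $\infty\in\sigma(\mathcal{A})$, $m_{u,v}(\infty)$ is the order of the pole at $s=0$ of $s\mapsto(-sA+E)^{-1}(sv+u)$ (again $0$ if there is no pole). *)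

theory Defs
  imports "HOL-Complex_Analysis.Complex_Analysis"
begin

datatype ext_complex = Fin complex | Infty

text \<open>The pair \<open>(E, A)\<close> stands for the pencil \<open>s E - A\<close>. Componentwise addition of pairs is then
  pointwise addition of pencils, see \<open>pencil_at_add\<close>.\<close>

type_synonym 'n pencil = "(complex^'n^'n) \<times> (complex^'n^'n)"

fun pencil_at :: "'n::finite pencil \<Rightarrow> complex \<Rightarrow> complex^'n^'n" where
  "pencil_at (E, A) s = (\<chi> i j. s * E $ i $ j - A $ i $ j)"

lemma pencil_at_add: "pencil_at (P + Q) s = pencil_at P s + pencil_at Q s"
  by (cases P; cases Q) (simp add: vec_eq_iff algebra_simps)

text \<open>The determinant is taken over the ring of polynomials in \<open>s\<close>.\<close>

fun regular_pencil :: "'n::finite pencil \<Rightarrow> bool" where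
  "regular_pencil (E, A) \<longleftrightarrow> det (\<chi> i j. [: - (A $ i $ j), E $ i $ j :]) \<noteq> 0"

fun pencil_spectrum :: "'n::finite pencil \<Rightarrow> ext_complex set" where
  "pencil_spectrum (E, A) =
     Fin ` {l. \<not> invertible (pencil_at (E, A) l)} \<union> (if invertible E then {} else {Infty})"

text \<open>Finiteness of the spectrum, so that sums over it are genuine.\<close>

lemma finite_pencil_spectrum:
  assumes "regular_pencil P"
  shows "finite (pencil_spectrum P)"
proof -
  obtain E A where P: "P = (E, A)" by (cases P)
  define p where "p = det (\<chi> i j. [: - (A $ i $ j), E $ i $ j :])"
  have "p \<noteq> 0" using assms by (simp add: P p_def)
  have "poly p s = det (pencil_at (E, A) s)" for s
    by (simp add: p_def det_def poly_sum poly_prod algebra_simps sign_def)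
  hence "{l. \<not> invertible (pencil_at (E, A) l)} = {l. poly p l = 0}"
    by (simp add: invertible_det_nz)
  with poly_roots_finite[OF \<open>p \<noteq> 0\<close>] show ?thesis by (simp add: P)
qed

text \<open>A chain of length \<open>m\<close> consists of the values \<open>g 0, \<dots>, g (m - 1)\<close>; other values of \<open>g\<close> are
  irrelevant. At a finite \<open>l\<close>, the equations are \<open>(A - l E) g\<^sub>0 = 0\<close> and \<open>(A - l E) g\<^sub>j = E g\<^sub>j\<^sub>-\<^sub>1\<close>.\<close>

fun jordan_chain ::
  "'n::finite pencil \<Rightarrow> ext_complex \<Rightarrow> nat \<Rightarrow> (nat \<Rightarrow> complex^'n) \<Rightarrow> bool" where
  "jordan_chain (E, A) (Fin l) m g \<longleftrightarrow>
     m \<ge> 1 \<and> g 0 \<noteq> 0 \<and> (\<chi> i j. A $ i $ j - l * E $ i $ j) *v g 0 = 0 \<and>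
     (\<forall>k. 1 \<le> k \<and> k \<le> m - 1 \<longrightarrow> (\<chi> i j. A $ i $ j - l * E $ i $ j) *v g k = E *v g (k - 1))"
| "jordan_chain (E, A) Infty m g \<longleftrightarrow>
     m \<ge> 1 \<and> g 0 \<noteq> 0 \<and> E *v g 0 = 0 \<and>
     (\<forall>k. 1 \<le> k \<and> k \<le> m - 1 \<longrightarrow> E *v g k = A *v g (k - 1))"

definition root_subspace :: "'n::finite pencil \<Rightarrow> ext_complex \<Rightarrow> (complex^'n) set" where
  "root_subspace P l = {0} \<union> {g k | m g k. jordan_chain P l m g \<and> k < m}"

text \<open>\<open>vec.dim\<close> is the dimension over the complex numbers (\<open>dim\<close> would be the real one).\<close>

abbreviation root_dim :: "'n::finite pencil \<Rightarrow> ext_complex \<Rightarrow> nat" where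
  "root_dim P l \<equiv> vec.dim (root_subspace P l)"

definition pole_order :: "(complex \<Rightarrow> complex) \<Rightarrow> complex \<Rightarrow> nat" where
  "pole_order f z = (if is_pole f z then nat (- zorder f z) else 0)"

definition vec_pole_order :: "(complex \<Rightarrow> complex^'n::finite) \<Rightarrow> complex \<Rightarrow> nat" where
  "vec_pole_order F z = Max (range (\<lambda>i. pole_order (\<lambda>s. F s $ i) z))"

text \<open>\<open>matrix_inv\<close> is unspecified at the singular points, but \<open>is_pole\<close> and \<open>zorder\<close> at \<open>z\<close> only
  depend on the values in a punctured neighbourhood of \<open>z\<close>.\<close>

fun pencil_pole_order ::
  "'n::finite pencil \<Rightarrow> complex^'n \<Rightarrow> complex^'n \<Rightarrow> ext_complex \<Rightarrow> nat" where
  "pencil_pole_order (E, A) u v (Fin l) =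
     vec_pole_order (\<lambda>s. matrix_inv (pencil_at (E, A) s) *v (s *s u + v)) l"
| "pencil_pole_order (E, A) u v Infty =
     vec_pole_order (\<lambda>s. matrix_inv (\<chi> i j. - s * A $ i $ j + E $ i $ j) *v (s *s v + u)) 0"

definition total_pole_order ::
  "'n::finite pencil \<Rightarrow> complex^'n \<Rightarrow> complex^'n \<Rightarrow> nat" where
  "total_pole_order P u v = (\<Sum>\<mu>\<in>pencil_spectrum P. pencil_pole_order P u v \<mu>)"

text \<open>\<open>x w\<^sup>*\<close>, with \<open>w\<^sup>*\<close> the conjugate transpose.\<close>

definition outer_cnj :: "complex^'n \<Rightarrow> complex^'n \<Rightarrow> complex^'n^'n::finite" where
  "outer_cnj x w = (\<chi> i j. x $ i * cnj (w $ j))"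

text \<open>\<open>(s u + v) w\<^sup>* = s (u w\<^sup>*) - (- v w\<^sup>*)\<close>.\<close>

definition rank_one_pencil ::
  "complex^'n \<Rightarrow> complex^'n \<Rightarrow> complex^'n \<Rightarrow> 'n::finite pencil" where
  "rank_one_pencil u v w = (outer_cnj u w, - outer_cnj v w)"

lemma pencil_at_rank_one_pencil:
  "pencil_at (rank_one_pencil u v w) s = outer_cnj (s *s u + v) w"
  by (simp add: rank_one_pencil_def outer_cnj_def vec_eq_iff algebra_simps)

end

theory Submission
  imports Defs "HOL-Computational_Algebra.Fundamental_Theorem_Algebra"
begin

text \<open>
  The dimension of the root subspace of a regular pencil at \<open>\<lambda>\<close> is the order of \<open>\<lambda>\<close> as a root of
  \<open>det (s E - A)\<close> (at infinity: the order of \<open>0\<close> as a root of the reversed determinant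
  \<open>det (E - s A)\<close>), so the dimensions over the whole spectrum add up to \<open>n\<close>. Since
  \<open>det (B + x w\<^sup>*) = det B (1 + w\<^sup>* B\<^sup>-\<^sup>1 x)\<close>, the perturbation lowers this order at \<open>\<lambda>\<close> by at most the
  pole order \<open>m\<^sub>u\<^sub>,\<^sub>v(\<lambda>)\<close>. All upper bounds follow from these lower bounds, because the dimensions for
  the perturbed pencil add up to \<open>n\<close> as well.
\<close>

no_notation fps_nth (infixl \<open>$\<close> 75)

subsection \<open>Determinants of pencils and generalized kernels\<close>

definition pencil_poly :: "'n::finite pencil \<Rightarrow> complex poly" where
  "pencil_poly P = det (\<chi> i j. [: - (snd P $ i $ j), fst P $ i $ j :])"

lemma regular_pencil_iff: "regular_pencil P \<longleftrightarrow> pencil_poly P \<noteq> 0"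
  by (cases P) (simp add: pencil_poly_def)

lemma poly_det: "poly (det M) s = det (\<chi> i j. poly (M $ i $ j) s)"
  by (simp add: det_def poly_sum poly_prod algebra_simps sign_def)

lemma poly_pencil_poly: "poly (pencil_poly P) s = det (pencil_at P s)"
  by (cases P) (simp add: pencil_poly_def poly_det algebra_simps)

lemma pencil_at_mult_vec:
  "pencil_at (E, A) s *v x = s *s (E *v x) - A *v x"
  by (simp add: vec_eq_iff matrix_vector_mult_def left_diff_distrib sum_subtractf
      sum_distrib_left mult.assoc)

declare pencil_at.simps [simp del]

lemma minus_matrix_mult_vec: "(- B) *v x = - ((B :: 'a::ring_1^'n^'m) *v x)"
  by (metis diff_0 matrix_vector_mult_0 matrix_vector_mult_diff_rdistrib)

lemma matrix_inv_mult_vec: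
  fixes B :: "'a::field^'n^'n"
  assumes "det B \<noteq> 0"
  shows "B *v (matrix_inv B *v x) = x" "matrix_inv B *v (B *v x) = x"
proof -
  have "\<exists>B'. B ** B' = mat 1 \<and> B' ** B = mat 1"
    using assms by (metis invertible_def invertible_det_nz)
  hence "B ** matrix_inv B = mat 1 \<and> matrix_inv B ** B = mat 1"
    unfolding matrix_inv_def by (rule someI_ex)
  thus "B *v (matrix_inv B *v x) = x" "matrix_inv B *v (B *v x) = x"
    by (simp_all add: matrix_vector_mul_assoc)
qed

lemma det_nz_iff_ker_trivial:
  fixes B :: "'a::field^'n^'n"
  shows "det B \<noteq> 0 \<longleftrightarrow> (\<forall>x. B *v x = 0 \<longrightarrow> x = 0)"
  by (metis invertible_det_nz invertible_left_inverse matrix_left_invertible_ker)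

text \<open>Lets determinant factorizations be checked on vectors, where the operator identities
  below are easiest to compute.\<close>

lemma det_mult_vec:
  fixes B :: "'a::field^'n^'n"
  assumes "\<And>x. B *v x = C *v (D *v x)"
  shows "det B = det C * det D"
proof -
  have "B = C ** D"
    unfolding matrix_eq by (simp add: assms matrix_vector_mul_assoc)
  thus ?thesis by (simp add: det_mul)
qed

section \<open>Iterates of a matrix and its generalized kernel\<close>

lemma funpow_mult_vec_add: "((*v) N ^^ k) (x + y) = ((*v) N ^^ k) x + ((*v) (N::'a::field^'n^'n) ^^ k) y"
  by (induction k) (simp_all add: matrix_vector_right_distrib)

lemma funpow_mult_vec_scale: "((*v) N ^^ k) (c *s x) = c *s ((*v) (N::'a::field^'n^'n) ^^ k) x"
  by (induction k) (simp_all add: vector_scalar_commute)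

lemma funpow_mult_vec_0 [simp]: "((*v) (N::'a::field^'n^'n) ^^ k) 0 = 0"
  by (induction k) simp_all

lemma funpow_mult_vec_diff: "((*v) N ^^ k) (x - y) = ((*v) N ^^ k) x - ((*v) (N::'a::field^'n^'n) ^^ k) y"
  by (induction k) (simp_all add: matrix_vector_mult_diff_distrib)

text \<open>The Fitting null component of \<open>N\<close>. The exponent may depend on the vector,
  so no bound by the dimension has to be proved.\<close>

definition gen_kernel :: "'a::field^'n^'n \<Rightarrow> ('a^'n) set" where
  "gen_kernel N = {x. \<exists>k. ((*v) N ^^ k) x = 0}"

lemma funpow_mult_vec_zero_mono:
  assumes "((*v) (N::'a::field^'n^'n) ^^ k) x = 0" "k \<le> l"
  shows "((*v) N ^^ l) x = 0"
proof -
  have "((*v) N ^^ l) x = ((*v) N ^^ (l - k)) (((*v) N ^^ k) x)"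
    using assms(2) by (metis comp_apply funpow_add le_add_diff_inverse2)
  thus ?thesis using assms(1) by simp
qed

lemma subspace_gen_kernel: "vec.subspace (gen_kernel N)"
proof (rule vec.subspaceI)
  show "0 \<in> gen_kernel N" by (simp add: gen_kernel_def)
next
  fix x y assume "x \<in> gen_kernel N" "y \<in> gen_kernel N"
  then obtain k l where "((*v) N ^^ k) x = 0" "((*v) N ^^ l) y = 0"
    by (auto simp: gen_kernel_def)
  hence "((*v) N ^^ max k l) x = 0" "((*v) N ^^ max k l) y = 0"
    by (auto intro: funpow_mult_vec_zero_mono)
  thus "x + y \<in> gen_kernel N"
    unfolding gen_kernel_def by (auto simp: funpow_mult_vec_add intro!: exI[of _ "max k l"])
next
  fix c x assume "x \<in> gen_kernel N"
  thus "c *s x \<in> gen_kernel N"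
    by (auto simp: gen_kernel_def funpow_mult_vec_scale)
qed

text \<open>Besides invariance this gives injectivity of \<open>N\<close> modulo
  \<open>gen_kernel N\<close>, which later makes the factor belonging to the complement
  invertible.\<close>

lemma gen_kernel_mult_iff: "N *v x \<in> gen_kernel N \<longleftrightarrow> x \<in> gen_kernel N"
proof
  assume "N *v x \<in> gen_kernel N"
  then obtain k where "((*v) N ^^ Suc k) x = 0"
    by (auto simp: gen_kernel_def funpow_swap1)
  thus "x \<in> gen_kernel N" unfolding gen_kernel_def by blast
next
  assume "x \<in> gen_kernel N"
  then obtain k where "((*v) N ^^ k) x = 0" by (auto simp: gen_kernel_def)
  hence "((*v) N ^^ Suc k) x = 0" by (rule funpow_mult_vec_zero_mono) simp
  thus "N *v x \<in> gen_kernel N" by (auto simp: gen_kernel_def funpow_swap1)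
qed

text \<open>Iterating the equation gives \<open>x = c ^ k *s N^k x\<close> for every
  \<open>k\<close>, and some power of \<open>N\<close> kills \<open>x\<close>.\<close>

lemma gen_kernel_fixed_scale:
  assumes "x \<in> gen_kernel N" "x = c *s (N *v x)"
  shows "x = 0"
proof -
  obtain k where "((*v) N ^^ k) x = 0" using assms(1) by (auto simp: gen_kernel_def)
  moreover have "x = c ^ k *s ((*v) N ^^ k) x" for k
  proof (induction k)
    case (Suc k)
    have "c ^ Suc k *s ((*v) N ^^ Suc k) x = c ^ k *s ((*v) N ^^ k) (c *s (N *v x))"
      by (simp add: funpow_mult_vec_scale funpow_swap1 mult.commute)
    thus ?case using Suc assms(2) by simp
  qed simp
  ultimately show ?thesis by (metis vec.scale_zero_right)
qed

text \<open>The pencil \<open>(Q, Q - 1)\<close> stands for the matrix \<open>y Q + (1 - Q)\<close>, and \<open>(M, -1)\<close> in the next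
  lemma for \<open>z M + 1\<close>.\<close>

lemma det_proj_scale:
  fixes K :: "(complex^'n) set"
  assumes "vec.subspace K"
  obtains Q :: "complex^'n^'n" where
    "\<And>x. Q *v x \<in> K" "\<And>x. x \<in> K \<Longrightarrow> Q *v x = x"
    "\<And>y. det (pencil_at (Q, Q - mat 1) y) = y ^ vec.dim K"
proof -
  obtain B where B: "B \<subseteq> K" "vec.independent B" "K \<subseteq> vec.span B" "card B = vec.dim K"
    using vec.basis_exists[of K] by blast
  define B' where "B' = vec.extend_basis B"
  have B': "B \<subseteq> B'" "vec.independent B'" "vec.span B' = UNIV"
    using vec.extend_basis_superset vec.independent_extend_basis vec.span_extend_basis B(2)
    by (auto simp: B'_def)
  have fin: "finite B'" by (simp add: B'(2) vec.finiteI_independent)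
  have "card B' = CARD('n)"
    using B'(2,3) by (metis vec.dim_UNIV vec.dim_eq_card_independent vec.dim_span card_cart_basis)
  then obtain b :: "'n \<Rightarrow> complex^'n" where b: "bij_betw b UNIV B'"
    using fin by (metis finite_class.finite_UNIV finite_same_card_bij)
  \<comment> \<open>The columns of \<open>S\<close> are the extended basis and \<open>D\<close>
    marks those taken from the basis \<open>B\<close> of \<open>K\<close>, so \<open>Q\<close> below
    projects onto \<open>K\<close> along the span of the remaining basis vectors.\<close>
  define S :: "complex^'n^'n" where "S = (\<chi> i j. b j $ i)"
  define d :: "'n \<Rightarrow> complex" where "d j = (if b j \<in> B then 1 else 0)" for j
  define D :: "complex^'n^'n" where "D = (\<chi> i j. if i = j then d j else 0)"
  have Sx: "S *v x = (\<Sum>j\<in>UNIV. x $ j *s b j)" for x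
    by (simp add: S_def matrix_vector_mult_def vec_eq_iff mult.commute)
  have Saxis: "S *v axis j 1 = b j" for j
    by (simp add: Sx axis_def if_distrib if_distribR cong: if_cong)
  have "surj ((*v) S)"
  proof -
    have "vec.span B' \<subseteq> range ((*v) S)"
    proof (rule vec.span_minimal)
      show "B' \<subseteq> range ((*v) S)"
      proof
        fix y assume "y \<in> B'"
        then obtain j where "y = b j" using b by (auto simp: bij_betw_def)
        thus "y \<in> range ((*v) S)" using Saxis by (metis rangeI)
      qed
      show "vec.subspace (range ((*v) S))"
        by (metis matrix_vector_mul_linear_gen vec.linear_subspace_image vec.subspace_UNIV)
    qed
    thus ?thesis using B'(3) by auto
  qed
  hence "det S \<noteq> 0"
    by (metis invertible_det_nz invertible_right_inverse matrix_right_invertible_surjective)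
  note Sinv = matrix_inv_mult_vec[OF this]
  have Dx: "(D *v x) $ i = d i * x $ i" for x i
    by (simp add: D_def matrix_vector_mult_def if_distrib if_distribR cong: if_cong)
  define Q where "Q = S ** D ** matrix_inv S"
  have Qx: "Q *v x = S *v (D *v (matrix_inv S *v x))" for x
    by (simp add: Q_def flip: matrix_vector_mul_assoc)
  have QB: "Q *v x = x" if xB: "x \<in> B" for x
  proof -
    obtain j where j: "x = b j"
      using xB B'(1) bij_betw_imp_surj_on[OF b] by blast
    have "x = S *v axis j 1" using j Saxis by simp
    moreover have "D *v axis j 1 = axis j 1"
      using xB j by (simp add: vec_eq_iff Dx axis_def d_def)
    ultimately show ?thesis by (simp add: Qx Sinv)
  qed
  show thesis
  proof
    fix x
    show "Q *v x \<in> K"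
      unfolding Qx Sx
    proof (intro vec.subspace_sum assms)
      fix j show "(D *v (matrix_inv S *v x)) $ j *s b j \<in> K"
        using B(1) assms by (auto simp: Dx d_def intro: vec.subspace_scale vec.subspace_0)
    qed
  next
    fix x assume "x \<in> K"
    hence "x \<in> vec.span B" using B(3) by blast
    thus "Q *v x = x"
    proof (induction rule: vec.span_induct_alt)
      case (step c x y)
      thus ?case by (simp add: matrix_vector_right_distrib vector_scalar_commute QB)
    qed simp
  next
    fix y
    define e :: "'n \<Rightarrow> complex" where "e j = (if b j \<in> B then y else 1)" for j
    define Dy :: "complex^'n^'n" where "Dy = (\<chi> i j. if i = j then e j else 0)"
    have Dyx: "(Dy *v x) $ i = e i * x $ i" for x i
      by (simp add: Dy_def matrix_vector_mult_def if_distrib if_distribR cong: if_cong)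
    have Dy: "Dy *v x = y *s (D *v x) - D *v x + x" for x
      by (simp add: vec_eq_iff Dyx Dx d_def e_def algebra_simps)
    have "pencil_at (Q, Q - mat 1) y *v (S *v x) = S *v (Dy *v x)" for x
      unfolding pencil_at_mult_vec Dy
      by (simp add: Qx Sinv matrix_vector_mult_diff_rdistrib matrix_vector_right_distrib
          matrix_vector_mult_diff_distrib vector_scalar_commute)
    hence "pencil_at (Q, Q - mat 1) y ** S = S ** Dy"
      by (simp add: matrix_eq flip: matrix_vector_mul_assoc)
    hence "det (pencil_at (Q, Q - mat 1) y) * det S = det S * det Dy"
      by (metis det_mul)
    hence "det (pencil_at (Q, Q - mat 1) y) = det Dy" using \<open>det S \<noteq> 0\<close> by simp
    also have "det Dy = (\<Prod>j\<in>UNIV. if b j \<in> B then y else 1)"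
      by (subst det_diagonal) (auto simp: Dy_def e_def)
    also have "\<dots> = (\<Prod>x\<in>B'. if x \<in> B then y else 1)"
      by (rule prod.reindex_bij_betw[OF b])
    also have "\<dots> = y ^ card B"
      using fin B'(1) by (simp add: prod.If_cases Int_absorb1)
    finally show "det (pencil_at (Q, Q - mat 1) y) = y ^ vec.dim K" by (simp add: B(4))
  qed
qed

lemma det_one_plus_nilpotent:
  fixes M N :: "complex^'n^'n"
  assumes "\<And>x. M *v x \<in> gen_kernel N" "\<And>x. x \<in> gen_kernel N \<Longrightarrow> M *v x = N *v x"
  shows "det (pencil_at (M, - mat 1) z) = 1"
proof -
  define p where "p = pencil_poly (M, - mat 1)"
  \<comment> \<open>A kernel vector lies in the image of \<open>M\<close>, hence in the generalized
    kernel, where \<open>M\<close> acts as \<open>N\<close> and no nonzero vector satisfies such an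
    equation. A complex polynomial without roots is constant, and \<open>p\<close> is 1 at
    0.\<close>
  have "poly p z \<noteq> 0" for z
    unfolding p_def poly_pencil_poly det_nz_iff_ker_trivial
  proof (intro allI impI)
    fix x assume "pencil_at (M, - mat 1) z *v x = 0"
    hence "x + z *s (M *v x) = 0"
      by (simp add: pencil_at_mult_vec minus_matrix_mult_vec add.commute)
    hence eq: "x = (- z) *s (M *v x)" by (simp add: eq_neg_iff_add_eq_0)
    have "(- z) *s (M *v x) \<in> gen_kernel N"
      by (intro vec.subspace_scale subspace_gen_kernel assms(1))
    hence x: "x \<in> gen_kernel N" by (simp only: eq[symmetric])
    show "x = 0"
      by (rule gen_kernel_fixed_scale[OF x, of "- z"]) (use eq assms(2)[OF x] in simp)
  qed
  hence "degree p = 0"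
    using alg_closed_imp_poly_has_root[of p] by blast
  hence "poly p z = poly p 0" by (auto elim: degree_eq_zeroE)
  also have "pencil_at (M, - mat 1) 0 = mat 1" by (simp add: vec_eq_iff pencil_at.simps)
  hence "poly p 0 = 1" by (simp add: p_def poly_pencil_poly)
  finally show ?thesis by (simp add: p_def poly_pencil_poly)
qed

subsection \<open>Root subspaces and the order of the determinant\<close>

text \<open>\<open>A - l E\<close> is minus the value of the pencil, whence the sign. The shift to
  \<open>Suc k\<close> removes the truncated subtractions and suits induction along the
  chain.\<close>

lemma jordan_chain_Fin_iff:
  "jordan_chain P (Fin l) m g \<longleftrightarrow> m \<ge> 1 \<and> g 0 \<noteq> 0 \<and> pencil_at P l *v g 0 = 0 \<and>
     (\<forall>k. Suc k < m \<longrightarrow> - (pencil_at P l *v g (Suc k)) = fst P *v g k)"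
proof (cases P)
  case (Pair E A)
  have "(\<chi> i j. A $ i $ j - l * E $ i $ j) = - pencil_at P l"
    by (simp add: Pair vec_eq_iff pencil_at.simps)
  moreover have idx: "(\<forall>k. 1 \<le> k \<and> k \<le> m - 1 \<longrightarrow> R k (k - 1)) \<longleftrightarrow> (\<forall>k. Suc k < m \<longrightarrow> R (Suc k) k)" for R
    by (metis One_nat_def Suc_le_D Suc_pred diff_Suc_1 le_add1 le_imp_less_Suc less_Suc_eq_le
        less_Suc_eq_0_disj not_less_zero plus_1_eq_Suc diff_is_0_eq' linorder_not_le zero_less_diff)
  ultimately show ?thesis
    using idx[of "\<lambda>i j. - (pencil_at (E, A) l *v g i) = E *v g j"]
    unfolding Pair jordan_chain.simps by (simp add: minus_matrix_mult_vec)
qed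

text \<open>Multiplying the chain equations by the injective \<open>J\<close> keeps the chains. By
  \<open>NT\<close>, \<open>T\<close> is a polynomial in \<open>N\<close>, so it commutes with
  \<open>N\<close> and is onto on each \<open>ker N^k\<close>. Hence the \<open>k\<close>-th chain
  element is killed by \<open>N^(k+1)\<close>, and conversely every vector of the generalized kernel
  ends a chain.\<close>

lemma root_subspace_eq_gen_kernel:
  fixes N T J :: "complex^'n^'n"
  assumes J: "\<And>x. J *v x = 0 \<longleftrightarrow> x = 0"
    and N: "\<And>x. J *v (pencil_at P l *v x) = N *v x"
    and T: "\<And>x. J *v (fst P *v x) = T *v x"
    and NT: "\<And>x. N *v x = x - c *s (T *v x)" and "c \<noteq> 0"
  shows "root_subspace P (Fin l) = gen_kernel N"
proof -
  have Jinj: "J *v x = J *v y \<longleftrightarrow> x = y" for x y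
    using J[of "x - y"] by (simp add: matrix_vector_mult_diff_distrib)
  have chain: "jordan_chain P (Fin l) m g \<longleftrightarrow> m \<ge> 1 \<and> g 0 \<noteq> 0 \<and> N *v g 0 = 0 \<and>
     (\<forall>k. Suc k < m \<longrightarrow> - (N *v g (Suc k)) = T *v g k)" for m g
  proof -
    have "- (pencil_at P l *v x) = fst P *v y \<longleftrightarrow> - (N *v x) = T *v y" for x y
      using Jinj[of "- (pencil_at P l *v x)" "fst P *v y"]
        matrix_vector_mult_diff_distrib[of J 0 "pencil_at P l *v x"]
      by (simp add: T flip: N)
    thus ?thesis unfolding jordan_chain_Fin_iff by (simp add: J flip: N)
  qed
  have T_eq: "T *v x = inverse c *s (x - N *v x)" for x
    using \<open>c \<noteq> 0\<close> by (simp add: NT)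
  have comm: "((*v) N ^^ k) (T *v x) = T *v (((*v) N ^^ k) x)" for k x
    unfolding T_eq funpow_mult_vec_scale funpow_mult_vec_diff by (simp add: funpow_swap1)
  \<comment> \<open>Solving \<open>T y = x\<close> within \<open>ker N\<^sup>k\<close> extends a chain downwards.\<close>
  have T_pre: "\<exists>y. T *v y = x \<and> ((*v) N ^^ k) y = 0" if "((*v) N ^^ k) x = 0" for k x
    using that
  proof (induction k arbitrary: x)
    case 0
    thus ?case by (intro exI[of _ 0]) simp
  next
    case (Suc k)
    hence "((*v) N ^^ k) (N *v x) = 0" by (simp add: funpow_swap1)
    then obtain y where y: "T *v y = N *v x" "((*v) N ^^ k) y = 0" using Suc.IH by blast
    \<comment> \<open>Here \<open>c *s T x = x - N x\<close> by \<open>NT\<close>, and the missing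
      \<open>N x\<close> is supplied by \<open>T y\<close>.\<close>
    have "T *v (y + c *s x) = x"
      by (simp add: matrix_vector_right_distrib vector_scalar_commute y(1) NT)
    moreover have "((*v) N ^^ Suc k) (y + c *s x) = 0"
      using Suc.prems funpow_mult_vec_zero_mono[OF y(2), of "Suc k"]
      by (simp only: funpow_mult_vec_add funpow_mult_vec_scale) simp
    ultimately show ?case by blast
  qed
  have mem: "((*v) N ^^ Suc k) (g k) = 0" if g: "jordan_chain P (Fin l) m g" and "k < m" for m g k
    using \<open>k < m\<close>
  proof (induction k)
    case 0
    thus ?case using g by (simp add: chain)
  next
    case (Suc k)
    hence "N *v g (Suc k) = - (T *v g k)" using g by (simp add: chain minus_equation_iff)
    hence "((*v) N ^^ Suc (Suc k)) (g (Suc k)) = ((*v) N ^^ Suc k) (0 - T *v g k)"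
      by (simp only: funpow_Suc_right o_apply) simp
    also have "\<dots> = - (T *v (((*v) N ^^ Suc k) (g k)))"
      unfolding funpow_mult_vec_diff comm by simp
    finally show ?case using Suc by simp
  qed
  have ex: "\<exists>g. jordan_chain P (Fin l) (Suc k) g \<and> g k = x"
    if "((*v) N ^^ Suc k) x = 0" "((*v) N ^^ k) x \<noteq> 0" for k x
    using that
  proof (induction k arbitrary: x)
    case 0
    thus ?case by (intro exI[of _ "\<lambda>_. x"]) (simp add: chain)
  next
    case (Suc k)
    have Nx: "((*v) N ^^ Suc k) (N *v x) = 0" "((*v) N ^^ k) (N *v x) \<noteq> 0"
      using Suc.prems by (simp_all add: funpow_swap1)
    \<comment> \<open>The chain equation makes \<open>-y\<close> the predecessor of
      \<open>x\<close>. As \<open>T\<close> commutes with \<open>N\<close>, \<open>N^k y\<close>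
      cannot vanish, so the induction hypothesis applies to \<open>-y\<close>.\<close>
    then obtain y where y: "T *v y = N *v x" "((*v) N ^^ Suc k) y = 0" using T_pre by blast
    have "((*v) N ^^ k) y \<noteq> 0"
      using Nx(2) comm[of k y] y(1) by auto
    hence "((*v) N ^^ k) ((-1) *s y) \<noteq> 0" "((*v) N ^^ Suc k) ((-1) *s y) = 0"
      unfolding funpow_mult_vec_scale y(2) by simp_all
    then obtain g where g: "jordan_chain P (Fin l) (Suc k) g" "g k = (-1) *s y"
      using Suc.IH by blast
    have chain': "jordan_chain P (Fin l) (Suc (Suc k)) (g(Suc k := x))"
      using g y(1) vector_scalar_commute[of T "-1" y] by (auto simp: chain less_Suc_eq)
    show ?case
      by (rule exI[of _ "g(Suc k := x)"], rule conjI[OF chain' fun_upd_same])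
  qed
  show ?thesis
  proof (intro equalityI subsetI)
    fix x assume "x \<in> root_subspace P (Fin l)"
    thus "x \<in> gen_kernel N"
      unfolding root_subspace_def using mem subspace_gen_kernel vec.subspace_0
      by (auto simp: gen_kernel_def simp del: funpow.simps)
  next
    fix x assume "x \<in> gen_kernel N"
    then obtain k where k: "((*v) N ^^ k) x = 0" by (auto simp: gen_kernel_def)
    show "x \<in> root_subspace P (Fin l)"
    proof (cases "x = 0")
      case False
      \<comment> \<open>Minimality of the exponent guarantees that the chain ending in
        \<open>x\<close> starts with a nonzero vector.\<close>
      define k where "k = (LEAST k. ((*v) N ^^ k) x = 0)"
      have "((*v) N ^^ k) x = 0" unfolding k_def using k by (rule LeastI)
      moreover from this False obtain j where "k = Suc j" by (cases k) auto
      moreover from this have "((*v) N ^^ j) x \<noteq> 0"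
        using not_less_Least[of j "\<lambda>k. ((*v) N ^^ k) x = 0"] by (simp add: k_def)
      ultimately show ?thesis using ex[of j x] unfolding root_subspace_def by auto
    qed (simp add: root_subspace_def)
  qed
qed

text \<open>Used where an identity is derived by dividing by a quantity that vanishes at one point:
  \<open>s - l\<close> for the factorization, \<open>s\<close> for the reversed determinant.\<close>

lemma poly_eqI_punctured:
  fixes p q :: "'a::{idom,ring_char_0} poly"
  assumes "\<And>s. s \<noteq> a \<Longrightarrow> poly p s = poly q s"
  shows "p = q"
proof (rule ccontr)
  assume "p \<noteq> q"
  hence "finite {s. poly (p - q) s = 0}" by (intro poly_roots_finite) simp
  moreover have "- {a} \<subseteq> {s. poly (p - q) s = 0}" using assms by auto
  ultimately have "finite (- {a})" by (rule rev_finite_subset)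
  thus False by (simp add: finite_compl infinite_UNIV_char_0)
qed

text \<open>Take \<open>s\<^sub>0\<close> outside the spectrum, \<open>J = (s\<^sub>0 E - A)\<^sup>-\<^sup>1\<close>, \<open>N = J (l E - A)\<close> and
  \<open>z = (s - l) / (s\<^sub>0 - l)\<close>. Then \<open>M = J (s E - A) = z + (1 - z) N\<close>, and with a projection \<open>Q\<close> onto the
  generalized kernel of \<open>N\<close>, which is invariant under \<open>M\<close>, one has the block-triangular factorization
  \<open>M = (Q + M (1 - Q)) (M Q + 1 - Q)\<close>. The first factor is invertible at \<open>z = 0\<close>; the second one is
  \<open>(1 + ((1 - z) / z) N Q) (z Q + 1 - Q)\<close>, where \<open>N Q\<close> is nilpotent, so its determinant is a power of \<open>z\<close>.\<close>

lemma root_dim_eq_order: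
  fixes P :: "'n::finite pencil"
  assumes "pencil_poly P \<noteq> 0"
  shows "root_dim P (Fin l) = order l (pencil_poly P)"
proof -
  obtain E A where P: "P = (E, A)" by (cases P)
  define p where "p = pencil_poly P"
  have "finite (insert l {s. poly p s = 0})"
    using assms poly_roots_finite by (simp add: p_def)
  then obtain s0 where s0: "s0 \<noteq> l" "poly p s0 \<noteq> 0"
    using ex_new_if_finite[OF infinite_UNIV_char_0] by blast
  define c where "c = s0 - l"
  define J where "J = matrix_inv (pencil_at P s0)"
  define N where "N = J ** pencil_at P l"
  define T where "T = J ** E"
  have "c \<noteq> 0" using s0(1) by (simp add: c_def)
  have det0: "det (pencil_at P s0) \<noteq> 0" using s0(2) by (simp add: p_def poly_pencil_poly)
  note Jinv = matrix_inv_mult_vec[OF det0, folded J_def]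
  have NT: "N *v x = x - c *s (T *v x)" for x
  proof -
    have "pencil_at P l *v x = pencil_at P s0 *v x - c *s (E *v x)"
      by (simp add: P pencil_at_mult_vec c_def vec.scale_left_diff_distrib)
    thus ?thesis
      by (simp add: N_def T_def Jinv matrix_vector_mult_diff_distrib vector_scalar_commute
          flip: matrix_vector_mul_assoc)
  qed
  have root: "root_subspace P (Fin l) = gen_kernel N"
  proof (rule root_subspace_eq_gen_kernel[OF _ _ _ NT \<open>c \<noteq> 0\<close>])
    show "J *v x = 0 \<longleftrightarrow> x = 0" for x
      by (metis Jinv(1) matrix_vector_mult_0_right)
  qed (simp_all add: N_def T_def P matrix_vector_mul_assoc)
  define k where "k = vec.dim (gen_kernel N)"
  obtain Q :: "complex^'n^'n" where Q: "\<And>x. Q *v x \<in> gen_kernel N" "\<And>x. x \<in> gen_kernel N \<Longrightarrow> Q *v x = x"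
    "\<And>y. det (pencil_at (Q, Q - mat 1) y) = y ^ k"
    using det_proj_scale[OF subspace_gen_kernel] unfolding k_def by metis
  have QQ: "Q *v (Q *v x) = Q *v x" "Q *v (N *v (Q *v x)) = N *v (Q *v x)" for x
    using Q(1,2) gen_kernel_mult_iff by auto
  \<comment> \<open>\<open>H\<close> encodes \<open>Q + M (1 - Q)\<close> as a pencil in
    \<open>z\<close>, obtained by inserting \<open>M = z + (1 - z) N\<close>; thus its determinant
    is a polynomial in \<open>z\<close>.\<close>
  define H where "H = (mat 1 - Q - N ** (mat 1 - Q), - (Q + N ** (mat 1 - Q)))"
  have Hx: "pencil_at H z *v x = z *s (x - Q *v x - N *v (x - Q *v x)) + Q *v x + N *v (x - Q *v x)"
    for z x
    by (simp add: H_def pencil_at_mult_vec minus_matrix_mult_vec matrix_vector_mult_diff_rdistrib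
        matrix_vector_mult_add_rdistrib flip: matrix_vector_mul_assoc)
  \<comment> \<open>Injectivity of \<open>N\<close> modulo its generalized kernel puts
    \<open>x - Q x\<close> into that kernel, so \<open>Q\<close> fixes it; but \<open>Q\<close> also
    annihilates it.\<close>
  have H0: "poly (pencil_poly H) 0 \<noteq> 0"
    unfolding poly_pencil_poly det_nz_iff_ker_trivial
  proof (intro allI impI)
    fix x assume "pencil_at H 0 *v x = 0"
    hence eq: "N *v (x - Q *v x) = - (Q *v x)"
      by (simp add: Hx add_eq_0_iff)
    hence "x - Q *v x \<in> gen_kernel N"
      by (metis Q(1) gen_kernel_mult_iff subspace_gen_kernel vec.subspace_neg)
    hence "x - Q *v x = Q *v (x - Q *v x)" by (simp add: Q(2))
    also have "\<dots> = 0" by (simp add: matrix_vector_mult_diff_distrib QQ)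
    finally have "x - Q *v x = 0" .
    with eq show "x = 0" by (metis eq_iff_diff_eq_0 matrix_vector_mult_0_right neg_equal_0_iff_equal)
  qed
  have p_eq: "poly p s * det J = ((s - l) / c) ^ k * poly (pencil_poly H) ((s - l) / c)"
    if "s \<noteq> l" for s
  proof -
    define z where "z = (s - l) / c"
    have "z \<noteq> 0" using that \<open>c \<noteq> 0\<close> by (simp add: z_def)
    define M where "M = J ** pencil_at P s"
    have Mx: "M *v x = z *s x + (1 - z) *s (N *v x)" for x
    proof -
      have "pencil_at P s *v x = pencil_at P l *v x + (s - l) *s (E *v x)"
        by (simp add: P pencil_at_mult_vec vec.scale_left_diff_distrib)
      hence "M *v x = N *v x + (s - l) *s (T *v x)"
        by (simp add: M_def N_def T_def matrix_vector_right_distrib vector_scalar_commute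
          matrix_vector_mult_diff_distrib
          flip: matrix_vector_mul_assoc)
      also have "(s - l) *s (T *v x) = z *s (x - N *v x)"
        using \<open>c \<noteq> 0\<close> by (simp add: NT z_def)
      finally show ?thesis by (simp add: algebra_simps vec.scale_left_diff_distrib vec.scale_right_diff_distrib)
    qed
    define F where "F = M ** Q + mat 1 - Q"
    have Fx: "F *v x = M *v (Q *v x) + x - Q *v x" for x
      by (simp add: F_def matrix_vector_mult_diff_rdistrib
        matrix_vector_mult_add_rdistrib flip: matrix_vector_mul_assoc)
    have QMQ: "Q *v (M *v (Q *v x)) = M *v (Q *v x)" for x
      by (simp add: Mx matrix_vector_right_distrib matrix_vector_mult_diff_distrib
          vector_scalar_commute QQ)
    have "det M = det (pencil_at H z) * det F"
    proof (rule det_mult_vec)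
      fix x
      have H': "pencil_at H z *v y = Q *v y + M *v (y - Q *v y)" for y
        by (simp add: Hx Mx vec.scale_left_diff_distrib vec.scale_right_diff_distrib)
      have QF: "Q *v (F *v x) = M *v (Q *v x)"
        by (simp add: Fx QMQ QQ matrix_vector_right_distrib matrix_vector_mult_diff_distrib)
      show "M *v x = pencil_at H z *v (F *v x)"
        unfolding H' QF by (simp add: Fx matrix_vector_mult_diff_distrib)
    qed
    also have "det F = det (pencil_at (N ** Q, - mat 1) ((1 - z) / z)) * det (pencil_at (Q, Q - mat 1) z)"
    proof (rule det_mult_vec)
      fix x
      define y where "y = z *s (Q *v x) - (Q *v x - x)"
      have "pencil_at (Q, Q - mat 1) z *v x = y"
        by (simp add: y_def pencil_at_mult_vec matrix_vector_mult_diff_rdistrib)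
      \<comment> \<open>\<open>Q\<close> annihilates the complementary part of \<open>y\<close>; the
        factor \<open>z\<close> that remains cancels the denominator in
        \<open>(1 - z) / z\<close>.\<close>
      moreover have "Q *v y = z *s (Q *v x)"
        by (simp add: y_def QQ matrix_vector_mult_diff_distrib vector_scalar_commute)
      ultimately show "F *v x = pencil_at (N ** Q, - mat 1) ((1 - z) / z) *v
          (pencil_at (Q, Q - mat 1) z *v x)"
        using \<open>z \<noteq> 0\<close>
        by (simp add: Fx Mx pencil_at_mult_vec minus_matrix_mult_vec vector_scalar_commute
            flip: matrix_vector_mul_assoc) (simp add: y_def)
    qed
    also have "det (pencil_at (N ** Q, - mat 1) ((1 - z) / z)) = 1"
      by (rule det_one_plus_nilpotent[of _ N])
        (simp_all add: Q gen_kernel_mult_iff flip: matrix_vector_mul_assoc)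
    finally show ?thesis
      by (simp add: M_def det_mul Q(3) p_def poly_pencil_poly z_def mult.commute)
  qed
  \<comment> \<open>Undoes the substitution \<open>z = (s - l) / c\<close>. As \<open>h\<close> does
    not vanish at \<open>l\<close>, the whole order of \<open>p\<close> at \<open>l\<close> comes
    from the power \<open>k\<close>.\<close>
  define h where "h = pcompose (pencil_poly H) [:- l / c, 1 / c:]"
  have h: "poly h s = poly (pencil_poly H) ((s - l) / c)" for s
    by (simp add: h_def poly_pcompose diff_divide_distrib)
  have "smult (det J * c ^ k) p = [:-l, 1:] ^ k * h"
  proof (rule poly_eqI_punctured[of l])
    fix s assume "s \<noteq> l"
    thus "poly (smult (det J * c ^ k) p) s = poly ([:-l, 1:] ^ k * h) s"
      using p_eq[of s] \<open>c \<noteq> 0\<close>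
      by (simp add: h poly_power power_divide divide_simps mult_ac)
  qed
  moreover have "poly h l \<noteq> 0" using H0 by (simp add: h)
  moreover have "det J * c ^ k \<noteq> 0"
  proof -
    have "det J \<noteq> 0" unfolding det_nz_iff_ker_trivial by (metis Jinv(1) matrix_vector_mult_0_right)
    thus ?thesis using \<open>c \<noteq> 0\<close> by simp
  qed
  ultimately have "order l p = order l ([:-l, 1:] ^ k * h)"
    by (metis order_smult)
  also have "\<dots> = k"
    using \<open>poly h l \<noteq> 0\<close> by (subst order_mult) (auto simp: order_power_n_n order_0I)
  finally show ?thesis by (simp add: root k_def p_def)
qed

subsection \<open>Rank-one perturbations\<close>

lemma outer_cnj_mult_vec: "outer_cnj y w *v x = (\<Sum>j\<in>UNIV. cnj (w $ j) * x $ j) *s y"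
  by (simp add: outer_cnj_def vec_eq_iff matrix_vector_mult_def sum_distrib_left mult_ac)

text \<open>The matrix determinant lemma. After the change of coordinates \<open>S\<close>, the
  matrix differs from the identity in column \<open>k\<close> only, and Cramer's rule evaluates both
  determinants.\<close>

lemma det_one_plus_outer_cnj:
  fixes y w :: "complex^'n"
  shows "det (mat 1 + outer_cnj y w) = 1 + (\<Sum>i\<in>UNIV. cnj (w $ i) * y $ i)"
proof (cases "w = 0")
  case True
  have "outer_cnj y w = 0"
    by (simp add: True outer_cnj_def vec_eq_iff)
  thus ?thesis by (simp add: True)
next
  case False
  then obtain k where k: "w $ k \<noteq> 0" by (auto simp: vec_eq_iff)
  \<comment> \<open>In the coordinates given by \<open>S\<close>, the row vector \<open>w\<^sup>*\<close> becomes a unit vector.\<close>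
  define S :: "complex^'n^'n" where "S = (\<chi> i j. if i = k then cnj (w $ j) else mat 1 $ i $ j)"
  have Sx: "(S *v x) $ i = (if i = k then \<Sum>j\<in>UNIV. cnj (w $ j) * x $ j else x $ i)" for x i
  proof (cases "i = k")
    case False
    hence "(S *v x) $ i = (mat 1 *v x) $ i"
      unfolding S_def matrix_vector_mult_def by simp
    thus ?thesis using False by simp
  qed (simp add: S_def matrix_vector_mult_def)
  have detS: "det S = cnj (w $ k)"
  proof -
    define a where "a = (\<chi> i. cnj (w $ i))"
    have "(\<Sum>i\<in>UNIV. a $ i *s row i (mat 1)) = a"
      by (simp add: vec_eq_iff row_def mat_def if_distrib cong: if_cong)
    \<comment> \<open>Row \<open>k\<close> is written as a combination of unit rows to fit the
      transposed Cramer lemma, which reads off its coefficient at \<open>k\<close>.\<close>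
    hence "S = (\<chi> i. if i = k then (\<Sum>i\<in>UNIV. a $ i *s row i (mat 1)) else row i (mat 1))"
      by (simp add: S_def a_def vec_eq_iff row_def)
    thus ?thesis using cramer_lemma_transpose[of k a "mat 1"] by (simp add: a_def)
  qed
  \<comment> \<open>\<open>C\<close> is the identity plus \<open>S y\<close> in column
    \<open>k\<close>; the seemingly idle \<open>mat 1 *v\<close> gives that column the shape
    Cramer's lemma expects.\<close>
  define C :: "complex^'n^'n" where
    "C = (\<chi> i j. if j = k then (mat 1 *v (axis k 1 + S *v y)) $ i else mat 1 $ i $ j)"
  have Cx: "C *v x = x + x $ k *s (S *v y)" for x
  proof -
    have "C $ i $ j * x $ j = mat 1 $ i $ j * x $ j + (if j = k then (S *v y) $ i * x $ k else 0)" for i j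
      unfolding C_def matrix_vector_mul_lid by (simp add: axis_def mat_def distrib_right)
    hence "(C *v x) $ i = (mat 1 *v x) $ i + (S *v y) $ i * x $ k" for i
      unfolding matrix_vector_mult_def[of C] matrix_vector_mult_def[of "mat 1"]
      by (simp add: sum.distrib)
    thus ?thesis by (simp add: vec_eq_iff mult.commute)
  qed
  have detC: "det C = 1 + (S *v y) $ k"
    unfolding C_def by (subst cramer_lemma) simp
  have "C *v (S *v x) = S *v ((mat 1 + outer_cnj y w) *v x)" for x
    unfolding Cx by (simp add: matrix_vector_mult_add_rdistrib outer_cnj_mult_vec
        matrix_vector_right_distrib vector_scalar_commute) (simp add: Sx)
  hence "C ** S = S ** (mat 1 + outer_cnj y w)"
    by (simp add: matrix_eq flip: matrix_vector_mul_assoc)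
  hence "det C * det S = det S * det (mat 1 + outer_cnj y w)" by (metis det_mul)
  hence "det (mat 1 + outer_cnj y w) = det C" using k detS by simp
  thus ?thesis by (simp add: detC Sx)
qed

text \<open>Factor out \<open>B\<close> and apply the previous determinant formula to
  \<open>y = B^(-1) x\<close>.\<close>

lemma det_plus_outer_cnj:
  assumes "det B \<noteq> 0"
  shows "det (B + outer_cnj x w) = det B * (1 + (\<Sum>i\<in>UNIV. cnj (w $ i) * (matrix_inv B *v x) $ i))"
  unfolding det_one_plus_outer_cnj[symmetric]
  by (rule det_mult_vec)
    (simp add: matrix_vector_mult_add_rdistrib outer_cnj_mult_vec matrix_vector_right_distrib
      vector_scalar_commute matrix_inv_mult_vec[OF assms])

section \<open>Pole orders compared with orders of vanishing\<close>

lemma poly_analytic_on: "poly (p :: complex poly) analytic_on S"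
proof -
  have "poly p holomorphic_on UNIV"
    unfolding holomorphic_on_def by (metis field_differentiable_at_within field_differentiable_def poly_DERIV)
  thus ?thesis
    by (metis analytic_on_open analytic_on_subset open_UNIV subset_UNIV)
qed

text \<open>Without a pole, meromorphy already gives a limit. At a pole, \<open>f\<close> is a
  holomorphic \<open>g\<close> divided by a power of \<open>s - z\<close>, and \<open>m\<close> is
  large enough to clear it. Pole orders enter the determinant estimate only through this
  limit.\<close>

lemma tendsto_mult_power_pole_order:
  assumes "f meromorphic_on {z}" "pole_order f z \<le> m"
  shows "\<exists>c. ((\<lambda>s. (s - z) ^ m * f s) \<longlongrightarrow> c) (at z)"
proof (cases "is_pole f z")
  case False
  hence "\<exists>c. f \<midarrow>z\<rightarrow> c"
    using assms(1) meromorphic_at_iff by (auto simp: not_essential_def)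
  then obtain c where "f \<midarrow>z\<rightarrow> c" ..
  hence "((\<lambda>s. (s - z) ^ m * f s) \<longlongrightarrow> (z - z) ^ m * c) (at z)"
    by (intro tendsto_intros)
  thus ?thesis ..
next
  case True
  define g where "g = zor_poly f z"
  have n: "nat (- zorder f z) \<le> m" using assms(2) True by (simp add: pole_order_def)
  have "isolated_singularity_at f z" using assms(1) meromorphic_at_iff by blast
  then obtain r where "r > 0" "f holomorphic_on ball z r - {z}"
    unfolding isolated_singularity_at_def by (auto simp: analytic_on_open open_delete)
  then obtain r where r: "r > 0" "g holomorphic_on cball z r"
    "\<forall>s\<in>cball z r - {z}. f s = g s / (s - z) ^ nat (- zorder f z)"
    using zorder_exist_pole[of f "ball z r" z] True by (auto simp: g_def)
  have "isCont g z"
    using r(1,2) by (metis centre_in_ball continuous_on_interior holomorphic_on_imp_continuous_on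
        interior_cball)
  hence "((\<lambda>s. (s - z) ^ (m - nat (- zorder f z)) * g s) \<longlongrightarrow> (z - z) ^ (m - nat (- zorder f z)) * g z) (at z)"
    by (intro tendsto_intros) (simp add: isCont_def)
  moreover have "\<forall>\<^sub>F s in at z. (s - z) ^ (m - nat (- zorder f z)) * g s = (s - z) ^ m * f s"
  proof -
    have "\<forall>\<^sub>F s in at z. s \<in> ball z r - {z}"
      using r(1) by (intro eventually_at_in_open) auto
    thus ?thesis
    proof eventually_elim
      case (elim s)
      have "(s - z) ^ m = (s - z) ^ (m - nat (- zorder f z)) * (s - z) ^ nat (- zorder f z)"
        using n by (simp flip: power_add)
      thus ?case using elim r(3) by auto
    qed
  qed
  ultimately show ?thesis by (blast intro: Lim_transform_eventually)
qed

text \<open>Otherwise cancelling the common power of \<open>s - z\<close> leaves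
  \<open>(s - z)^d p' f = q'\<close> with \<open>d > 0\<close>. The left side tends to 0 because
  \<open>f\<close> has a limit, contradicting that \<open>q'\<close> does not vanish at
  \<open>z\<close>.\<close>

lemma order_le_if_tendsto:
  fixes p q :: "complex poly"
  assumes "p \<noteq> 0" "q \<noteq> 0" "((\<lambda>s. f s) \<longlongrightarrow> c) (at z)"
    and "\<forall>\<^sub>F s in at z. (s - z) ^ m * poly q s = poly p s * f s"
  shows "order z p \<le> order z q + m"
proof (rule ccontr)
  assume less: "\<not> ?thesis"
  obtain p' where p': "p = [:-z, 1:] ^ order z p * p'" "\<not> [:-z, 1:] dvd p'"
    using order_decomp[OF assms(1)] by blast
  obtain q' where q': "q = [:-z, 1:] ^ order z q * q'" "\<not> [:-z, 1:] dvd q'"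
    using order_decomp[OF assms(2)] by blast
  define d where "d = order z p - (order z q + m)"
  have d: "d > 0" "order z p = order z q + m + d" using less by (auto simp: d_def)
  have "\<forall>\<^sub>F s in at z. (s - z) ^ d * poly p' s * f s = poly q' s"
    using assms(4) eventually_neq_at_within[of z z]
  proof eventually_elim
    case (elim s)
    have "poly p s = (s - z) ^ order z p * poly p' s"
      by (subst p') (simp add: poly_power)
    moreover have "poly q s = (s - z) ^ order z q * poly q' s"
      by (subst q') (simp add: poly_power)
    ultimately have "(s - z) ^ (order z q + m) * poly q' s
        = (s - z) ^ (order z q + m) * ((s - z) ^ d * poly p' s * f s)"
      using elim(1) by (simp add: d(2) power_add mult_ac)
    thus ?case using elim(2) by simp
  qed
  moreover have "((\<lambda>s. (s - z) ^ d * poly p' s * f s) \<longlongrightarrow> (z - z) ^ d * poly p' z * c) (at z)"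
    by (intro tendsto_intros assms(3))
  ultimately have "(poly q' \<longlongrightarrow> (z - z) ^ d * poly p' z * c) (at z)"
    by (rule Lim_transform_eventually[rotated])
  moreover have "(poly q' \<longlongrightarrow> poly q' z) (at z)"
    by (intro tendsto_intros)
  ultimately have "poly q' z = (z - z) ^ d * poly p' z * c"
    using tendsto_unique[OF at_neq_bot] by blast
  hence "poly q' z = 0" using d(1) by simp
  thus False using q'(2) by (simp add: poly_eq_0_iff_dvd)
qed

lemma eventually_poly_nz:
  fixes p :: "complex poly"
  assumes "p \<noteq> 0"
  shows "\<forall>\<^sub>F s in at z. poly p s \<noteq> 0"
proof -
  have "\<not> z islimpt {s. poly p s = 0}"
    using poly_roots_finite[OF assms] by (rule islimpt_finite)
  thus ?thesis by (simp add: islimpt_iff_eventually)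
qed

lemma pole_order_le_vec_pole_order: "pole_order (\<lambda>s. F s $ i) z \<le> vec_pole_order F z"
  unfolding vec_pole_order_def by (intro Max_ge) auto

text \<open>The perturbed determinant is the old one times \<open>1 + w^* F\<close>, where
  \<open>F\<close> is the vector function defining the pole order; multiplying by
  \<open>(s - l)^m\<close> gives the second factor a limit.\<close>

lemma order_perturbed_ge:
  assumes reg: "pencil_poly P \<noteq> 0" "pencil_poly (P + rank_one_pencil u v w) \<noteq> 0"
  shows "order l (pencil_poly P) \<le> order l (pencil_poly (P + rank_one_pencil u v w))
    + pencil_pole_order P u v (Fin l)"
proof -
  define F where "F s = matrix_inv (pencil_at P s) *v (s *s u + v)" for s
  define m where "m = pencil_pole_order P u v (Fin l)"
  have m: "m = vec_pole_order F l"
    unfolding m_def F_def by (cases P) simp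
  have nz: "\<forall>\<^sub>F s in at l. det (pencil_at P s) \<noteq> 0"
    using eventually_poly_nz[OF reg(1)] by (simp add: poly_pencil_poly)
  have "(\<lambda>s. F s $ i) meromorphic_on {l}" for i
  proof -
    obtain E A where P: "P = (E, A)" by (cases P)
    \<comment> \<open>The numerator in Cramer's rule for entry \<open>i\<close> of \<open>F\<close>:
      near \<open>l\<close> this entry is a quotient of polynomials, hence meromorphic.\<close>
    define R where "R = det (\<chi> k j. if j = i then [:v $ k, u $ k:] else [: - (A $ k $ j), E $ k $ j :])"
    have "(\<lambda>s. poly R s / poly (pencil_poly P) s) meromorphic_on {l}"
      by (intro meromorphic_intros analytic_on_imp_meromorphic_on poly_analytic_on)
    moreover have "\<forall>\<^sub>F s in at l. poly R s / poly (pencil_poly P) s = F s $ i"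
      using nz
    proof eventually_elim
      case (elim s)
      have "poly R s = det (\<chi> k j. if j = i then (pencil_at P s *v F s) $ k else pencil_at P s $ k $ j)"
        unfolding R_def poly_det F_def matrix_inv_mult_vec[OF elim]
        by (intro arg_cong[where f = det]) (simp add: vec_eq_iff P pencil_at.simps)
      also have "\<dots> = F s $ i * det (pencil_at P s)" by (rule cramer_lemma)
      finally show ?case using elim by (simp add: poly_pencil_poly)
    qed
    ultimately show ?thesis
      by (subst (asm) meromorphic_on_cong) auto
  qed
  hence "\<exists>c. ((\<lambda>s. (s - l) ^ m * F s $ i) \<longlongrightarrow> c) (at l)" for i
    unfolding m by (intro tendsto_mult_power_pole_order pole_order_le_vec_pole_order)
  then obtain c where c: "((\<lambda>s. (s - l) ^ m * F s $ i) \<longlongrightarrow> c i) (at l)" for i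
    by metis
  define f where "f s = (s - l) ^ m + (\<Sum>i\<in>UNIV. cnj (w $ i) * ((s - l) ^ m * F s $ i))" for s
  have "(f \<longlongrightarrow> (l - l) ^ m + (\<Sum>i\<in>UNIV. cnj (w $ i) * c i)) (at l)"
    unfolding f_def by (intro tendsto_intros c)
  moreover have "\<forall>\<^sub>F s in at l. (s - l) ^ m * poly (pencil_poly (P + rank_one_pencil u v w)) s
      = poly (pencil_poly P) s * f s"
    using nz
  proof eventually_elim
    case (elim s)
    show ?case
      by (simp add: poly_pencil_poly pencil_at_add pencil_at_rank_one_pencil
          det_plus_outer_cnj[OF elim] f_def F_def distrib_left sum_distrib_left mult_ac)
  qed
  ultimately show ?thesis
    unfolding m_def[symmetric] by (rule order_le_if_tendsto[OF reg])
qed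

subsection \<open>The point at infinity and the total multiplicity\<close>

text \<open>Each Leibniz term is a product of \<open>CARD('n)\<close> entries of degree at most 1.
  The bound makes the later difference of \<open>CARD('n)\<close> and the degree a genuine
  subtraction.\<close>

lemma degree_pencil_poly_le: "degree (pencil_poly (P :: 'n::finite pencil)) \<le> CARD('n)"
proof -
  have "degree (of_int (sign p) * (\<Prod>i\<in>UNIV. (\<chi> i j. [: - (snd P $ i $ j), fst P $ i $ j :]) $ i $ p i)) \<le> CARD('n)"
    for p :: "'n \<Rightarrow> 'n"
  proof -
    have "degree (\<Prod>i\<in>UNIV. [: - (snd P $ i $ p i), fst P $ i $ p i :])
        \<le> sum (degree \<circ> (\<lambda>i. [: - (snd P $ i $ p i), fst P $ i $ p i :])) UNIV"
      by (rule degree_prod_sum_le) simp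
    also have "\<dots> \<le> (\<Sum>i\<in>(UNIV::'n set). 1)" by (rule sum_mono) simp
    finally show ?thesis
      using degree_mult_le[of "of_int (sign p)"] by (simp add: le_trans sign_def)
  qed
  thus ?thesis unfolding pencil_poly_def det_def by (intro degree_sum_le) auto
qed

text \<open>\<open>s (- A) - (- E) = E - s A\<close>: the reversed pencil exchanges infinity and \<open>0\<close>.\<close>

definition reverse_pencil :: "'n::finite pencil \<Rightarrow> 'n pencil" where
  "reverse_pencil P = (- snd P, - fst P)"

text \<open>Reversal swaps \<open>u\<close> and \<open>v\<close>, matching the numerator
  \<open>s v + u\<close> in the pole order at infinity.\<close>

lemma reverse_pencil_add_rank_one:
  "reverse_pencil (P + rank_one_pencil u v w) = reverse_pencil P + rank_one_pencil v u w"
  by (simp add: reverse_pencil_def rank_one_pencil_def plus_prod_def)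

lemma root_subspace_Infty: "root_subspace P Infty = root_subspace (reverse_pencil P) (Fin 0)"
proof (cases P)
  case (Pair E A)
  have "(\<chi> i j. (- E) $ i $ j - 0 * (- A) $ i $ j) = - E" by (simp add: vec_eq_iff)
  hence "jordan_chain P Infty m g \<longleftrightarrow> jordan_chain (reverse_pencil P) (Fin 0) m g" for m g
    unfolding Pair reverse_pencil_def fst_conv snd_conv jordan_chain.simps
    by (simp add: minus_matrix_mult_vec)
  thus ?thesis by (simp add: root_subspace_def)
qed

lemma pencil_at_reverse:
  "pencil_at (reverse_pencil (E, A)) s = (\<chi> i j. - s * A $ i $ j + E $ i $ j)"
  by (simp add: reverse_pencil_def pencil_at.simps vec_eq_iff)

lemma pencil_pole_order_Infty:
  "pencil_pole_order P u v Infty = pencil_pole_order (reverse_pencil P) v u (Fin 0)"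
proof (cases P)
  case (Pair E A)
  have "reverse_pencil P = (- A, - E)" by (simp add: Pair reverse_pencil_def)
  thus ?thesis
    using pencil_at_reverse[of E A] by (simp add: Pair)
qed

text \<open>For nonzero \<open>s\<close>, \<open>E - s A\<close> is \<open>s\<close> times the
  pencil at \<open>1/s\<close>, so its determinant is \<open>s^n p(1/s)\<close>; reflecting
  \<open>p\<close> absorbs \<open>s\<close> to the degree of \<open>p\<close>.\<close>

lemma pencil_poly_reverse:
  fixes P :: "'n::finite pencil"
  shows "pencil_poly (reverse_pencil P)
    = monom 1 (CARD('n) - degree (pencil_poly P)) * reflect_poly (pencil_poly P)"
proof (rule poly_eqI_punctured[of 0])
  fix s :: complex assume s: "s \<noteq> 0"
  obtain E A where P: "P = (E, A)" by (cases P)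
  have "pencil_at (reverse_pencil P) s = (\<chi> i. s *s pencil_at P (inverse s) $ i)"
    using s by (simp add: P pencil_at_reverse pencil_at.simps vec_eq_iff right_diff_distrib)
  hence "poly (pencil_poly (reverse_pencil P)) s = s ^ CARD('n) * poly (pencil_poly P) (inverse s)"
    by (simp add: poly_pencil_poly det_rows_mul)
  also have "\<dots> = s ^ (CARD('n) - degree (pencil_poly P)) * poly (reflect_poly (pencil_poly P)) s"
    using degree_pencil_poly_le[of P] by (simp add: poly_reflect_poly_nz[OF s] flip: power_add mult.assoc)
  finally show "poly (pencil_poly (reverse_pencil P)) s =
      poly (monom 1 (CARD('n) - degree (pencil_poly P)) * reflect_poly (pencil_poly P)) s"
    by (simp add: poly_monom)
qed

lemma pencil_poly_reverse_eq_0_iff: "pencil_poly (reverse_pencil P) = 0 \<longleftrightarrow> pencil_poly P = 0"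
  by (simp add: pencil_poly_reverse monom_eq_0_iff)

section \<open>Algebraic multiplicities on the extended complex plane\<close>

fun pencil_mult :: "'n::finite pencil \<Rightarrow> ext_complex \<Rightarrow> nat" where
  "pencil_mult P (Fin l) = order l (pencil_poly P)"
| "pencil_mult P Infty = order 0 (pencil_poly (reverse_pencil P))"

text \<open>The constant coefficient of the reflected polynomial is the leading coefficient of the
  original one, so only the monomial vanishes at 0.\<close>

lemma pencil_mult_Infty:
  fixes P :: "'n::finite pencil"
  assumes "pencil_poly P \<noteq> 0"
  shows "pencil_mult P Infty = CARD('n) - degree (pencil_poly P)"
  using assms by (simp add: pencil_poly_reverse order_mult monom_eq_0_iff order_0I)

lemma root_dim_eq_pencil_mult:
  assumes "pencil_poly P \<noteq> 0"
  shows "root_dim P l = pencil_mult P l"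
  using assms by (cases l)
    (simp_all add: root_subspace_Infty root_dim_eq_order pencil_poly_reverse_eq_0_iff)

lemma pencil_mult_le_perturbed:
  assumes "pencil_poly P \<noteq> 0" "pencil_poly (P + rank_one_pencil u v w) \<noteq> 0"
  shows "pencil_mult P l \<le> pencil_mult (P + rank_one_pencil u v w) l + pencil_pole_order P u v l"
proof (cases l)
  case Infty
  have "pencil_poly (reverse_pencil P + rank_one_pencil v u w) \<noteq> 0"
    using assms(2) by (simp add: pencil_poly_reverse_eq_0_iff flip: reverse_pencil_add_rank_one)
  thus ?thesis
    using order_perturbed_ge[of "reverse_pencil P" v u w 0] assms(1)
    by (simp add: Infty pencil_pole_order_Infty reverse_pencil_add_rank_one
        pencil_poly_reverse_eq_0_iff)
qed (use order_perturbed_ge[OF assms] in simp)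

lemma pencil_mult_eq_0:
  assumes "l \<notin> pencil_spectrum P"
  shows "pencil_mult P l = 0"
proof -
  obtain E A where P: "P = (E, A)" by (cases P)
  show ?thesis
  proof (cases l)
    case (Fin z)
    hence "det (pencil_at P z) \<noteq> 0" using assms by (simp add: P image_iff invertible_det_nz)
    thus ?thesis by (simp add: Fin order_0I poly_pencil_poly)
  next
    case Infty
    hence "det E \<noteq> 0" using assms by (simp add: P invertible_det_nz split: if_splits)
    moreover have "pencil_at (reverse_pencil P) 0 = E"
      by (simp add: P pencil_at_reverse vec_eq_iff)
    ultimately show ?thesis by (simp add: Infty order_0I poly_pencil_poly)
  qed
qed

text \<open>The finite roots contribute the degree of the determinant, by the fundamental theorem of
  algebra, and infinity contributes the missing \<open>n - degree\<close>.\<close>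

lemma sum_pencil_mult:
  fixes P :: "'n::finite pencil"
  assumes nz: "pencil_poly P \<noteq> 0" and S: "finite S" "pencil_spectrum P \<subseteq> S"
  shows "(\<Sum>l\<in>S. pencil_mult P l) = CARD('n)"
proof -
  define R where "R = {z. poly (pencil_poly P) z = 0}"
  have fin: "finite R" unfolding R_def by (rule poly_roots_finite[OF nz])
  have "(\<Sum>l\<in>S. pencil_mult P l) = (\<Sum>l\<in>S \<union> insert Infty (Fin ` R). pencil_mult P l)"
    using fin S by (intro sum.mono_neutral_left) (auto intro!: pencil_mult_eq_0)
  also have "\<dots> = (\<Sum>l\<in>insert Infty (Fin ` R). pencil_mult P l)"
  proof (intro sum.mono_neutral_right ballI)
    fix l assume "l \<in> S \<union> insert Infty (Fin ` R) - insert Infty (Fin ` R)"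
    then obtain z where "l = Fin z" "z \<notin> R" by (cases l) auto
    thus "pencil_mult P l = 0" by (simp add: R_def order_0I)
  qed (use S fin in auto)
  also have "\<dots> = pencil_mult P Infty + (\<Sum>z\<in>R. order z (pencil_poly P))"
    using fin by (subst sum.insert) (auto simp: sum.reindex inj_on_def)
  also have "(\<Sum>z\<in>R. order z (pencil_poly P)) = degree (pencil_poly P)"
    using nz size_proots_complex[of "pencil_poly P"]
    by (simp add: size_multiset_overloaded_eq R_def)
  finally show ?thesis using degree_pencil_poly_le[of P] pencil_mult_Infty[OF nz] by simp
qed

lemma sum_pencil_mult_le:
  fixes P :: "'n::finite pencil"
  assumes "pencil_poly P \<noteq> 0" "finite S"
  shows "(\<Sum>l\<in>S. pencil_mult P l) \<le> CARD('n)"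
proof -
  have fin: "finite (S \<union> pencil_spectrum P)"
    using assms finite_pencil_spectrum regular_pencil_iff by blast
  have "(\<Sum>l\<in>S. pencil_mult P l) \<le> (\<Sum>l\<in>S \<union> pencil_spectrum P. pencil_mult P l)"
    using fin by (intro sum_mono2) auto
  thus ?thesis using sum_pencil_mult[OF assms(1) fin] by simp
qed

theorem proposition6p1:
  fixes E A :: "complex^'n^'n" and u v w :: "complex^'n"
  assumes "regular_pencil (E, A)"
    and "regular_pencil ((E, A) + rank_one_pencil u v w)"
  shows
    "(\<forall>l \<in> pencil_spectrum (E, A).
        int (root_dim (E, A) l) - int (pencil_pole_order (E, A) u v l)
          \<le> int (root_dim ((E, A) + rank_one_pencil u v w) l) \<and>
        int (root_dim ((E, A) + rank_one_pencil u v w) l)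
          \<le> int (root_dim (E, A) l) + int (total_pole_order (E, A) u v)
              - int (pencil_pole_order (E, A) u v l)) \<and>
     (\<forall>l. l \<notin> pencil_spectrum (E, A) \<longrightarrow>
        0 \<le> root_dim ((E, A) + rank_one_pencil u v w) l \<and>
        root_dim ((E, A) + rank_one_pencil u v w) l \<le> total_pole_order (E, A) u v) \<and>
     int (\<Sum>l \<in> pencil_spectrum (E, A). root_dim ((E, A) + rank_one_pencil u v w) l)
       \<ge> int CARD('n) - int (total_pole_order (E, A) u v) \<and>
     (\<Sum>l \<in> pencil_spectrum ((E, A) + rank_one_pencil u v w) - pencil_spectrum (E, A).
         root_dim ((E, A) + rank_one_pencil u v w) l) \<le> total_pole_order (E, A) u v"
proof -
  define P where "P = (E, A)"
  define P' where "P' = (E, A) + rank_one_pencil u v w"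
  define \<sigma> where "\<sigma> = pencil_spectrum P"
  define m where "m = pencil_pole_order P u v"
  define M where "M = total_pole_order P u v"
  have nz: "pencil_poly P \<noteq> 0" "pencil_poly P' \<noteq> 0"
    using assms unfolding regular_pencil_iff P_def P'_def by auto
  have fin: "finite \<sigma>" "finite (pencil_spectrum P')"
    unfolding \<sigma>_def P_def P'_def by (intro finite_pencil_spectrum assms)+
  have le: "pencil_mult P l \<le> pencil_mult P' l + m l" for l
    using pencil_mult_le_perturbed[of P u v w l] nz by (simp add: P_def P'_def m_def)
  have M: "M = (\<Sum>l\<in>\<sigma>. m l)" by (simp add: M_def total_pole_order_def \<sigma>_def m_def)
  have sum: "(\<Sum>l\<in>\<sigma>. pencil_mult P l) = CARD('n)"
    using sum_pencil_mult[OF nz(1)] fin(1) by (simp add: \<sigma>_def)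
  have sum_le: "(\<Sum>l\<in>T. pencil_mult P l) \<le> (\<Sum>l\<in>T. pencil_mult P' l) + (\<Sum>l\<in>T. m l)" for T
    using sum_mono[of T "pencil_mult P"] le by (simp flip: sum.distrib)
  have inside: "CARD('n) \<le> (\<Sum>l\<in>\<sigma>. pencil_mult P' l) + M"
    using sum_le[of \<sigma>] by (simp add: sum M)
  \<comment> \<open>At least \<open>n - M\<close> of the total multiplicity \<open>n\<close> of
    \<open>P'\<close> already sits in \<open>\<sigma>\<close>.\<close>
  have outside: "(\<Sum>l\<in>T. pencil_mult P' l) \<le> M" if "finite T" "T \<inter> \<sigma> = {}" for T
    using sum_pencil_mult_le[OF nz(2), of "T \<union> \<sigma>"] inside that fin(1)
    by (simp add: sum.union_disjoint)
  \<comment> \<open>The lower bounds on \<open>\<sigma> - {l}\<close> show that \<open>P'\<close>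
    has at least \<open>n - pencil_mult P l - (M - m l)\<close> there, and the rest of the total
    \<open>n\<close> bounds what is left for \<open>l\<close>.\<close>
  have upper: "pencil_mult P' l + m l \<le> pencil_mult P l + M" if "l \<in> \<sigma>" for l
    using sum_le[of "\<sigma> - {l}"] sum_pencil_mult_le[OF nz(2) fin(1)] sum M
      sum.remove[OF fin(1) that, of m] sum.remove[OF fin(1) that, of "pencil_mult P"]
      sum.remove[OF fin(1) that, of "pencil_mult P'"]
    by linarith
  have "pencil_mult P' l \<le> M" if "l \<notin> \<sigma>" for l
    using outside[of "{l}"] that by simp
  moreover have "(\<Sum>l\<in>pencil_spectrum P' - \<sigma>. pencil_mult P' l) \<le> M"
    using fin(2) by (intro outside) auto
  moreover have "int (pencil_mult P l) - int (m l) \<le> int (pencil_mult P' l)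
      \<and> int (pencil_mult P' l) \<le> int (pencil_mult P l) + int M - int (m l)" if "l \<in> \<sigma>" for l
    using upper[OF that] le[of l] by linarith
  moreover have "int (\<Sum>l\<in>\<sigma>. pencil_mult P' l) \<ge> int CARD('n) - int M"
    using inside by linarith
  ultimately show ?thesis
    unfolding P'_def[symmetric] unfolding P_def[symmetric] root_dim_eq_pencil_mult[OF nz(1)]
      root_dim_eq_pencil_mult[OF nz(2)] \<sigma>_def[symmetric] M_def[symmetric] m_def[symmetric]
    by blast
qed

end
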